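(* For every $n\ge1$ and all two-sided ideals $I,J$ of $\mathbb{S}_n$, we have $IJ=JI$.
   Context: $K$ is a field. $\mathbb{S}_n$ is the $K$-algebra generated by $x_1,\dots,x_n,y_1,\dots,y_n$ subject to the defining relations $y_ix_i=1$ for all $i$, and $[x_i,y_j]=[x_i,x_j]=[y_i,y_j]=0$ for all $i\ne j$, where $[a,b]=ab-ba$. *)

theory Defs
  imports "HOL-Algebra.Ideal_Product" "HOL-Algebra.QuotRing"
begin

text \<open>Generators of the free algebra: X i stands for x_(i+1), Y i for y_(i+1)
  (0-based indices i < n).\<close>
datatype gen = X nat | Y nat

definition gens :: "nat \<Rightarrow> gen set" where
  "gens n = {X i | i. i < n} \<union> {Y i | i. i < n}"

text \<open>The free associative K-algebra on the 2n generators, realised as finitely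
  supported K-valued functions on words over the generators (noncommutative polynomials).\<close>
definition free_carrier :: "nat \<Rightarrow> (gen list \<Rightarrow> 'k::field) set" where
  "free_carrier n = {f. finite {w. f w \<noteq> 0} \<and> (\<forall>w. f w \<noteq> 0 \<longrightarrow> set w \<subseteq> gens n)}"

definition free_mult :: "(gen list \<Rightarrow> 'k::field) \<Rightarrow> (gen list \<Rightarrow> 'k) \<Rightarrow> gen list \<Rightarrow> 'k" where
  "free_mult f g = (\<lambda>w. \<Sum>i\<le>length w. f (take i w) * g (drop i w))"

definition mon :: "gen list \<Rightarrow> gen list \<Rightarrow> 'k::field" where
  "mon u = (\<lambda>w. if w = u then 1 else 0)"

definition free_alg :: "nat \<Rightarrow> (gen list \<Rightarrow> 'k::field) ring" where
  "free_alg n = \<lparr> carrier = free_carrier n,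
                  mult = free_mult,
                  one = mon [],
                  zero = (\<lambda>w. 0),
                  add = (\<lambda>f g w. f w + g w) \<rparr>"

definition rels :: "nat \<Rightarrow> (gen list \<Rightarrow> 'k::field) set" where
  "rels n =
     {(\<lambda>w. mon [Y i, X i] w - mon [] w) | i. i < n}
   \<union> {(\<lambda>w. mon [X i, Y j] w - mon [Y j, X i] w) | i j. i < n \<and> j < n \<and> i \<noteq> j}
   \<union> {(\<lambda>w. mon [X i, X j] w - mon [X j, X i] w) | i j. i < n \<and> j < n \<and> i \<noteq> j}
   \<union> {(\<lambda>w. mon [Y i, Y j] w - mon [Y j, Y i] w) | i j. i < n \<and> j < n \<and> i \<noteq> j}"

definition S :: "nat \<Rightarrow> (gen list \<Rightarrow> 'k::field) set ring" where
  "S n = FactRing (free_alg n) (genideal (free_alg n) (rels n))"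

end

theory Submission
  imports Defs
begin

text \<open>
  Let \<open>p\<^sub>i = 1 - x\<^sub>i y\<^sub>i\<close>. Every product \<open>a b\<close> with \<open>a \<in> I\<close> and \<open>b \<in> J\<close> is shown to lie in \<open>JI\<close>,
  working in the corners \<open>e S e\<close> where \<open>e\<close> is a product of idempotents \<open>p\<^sub>i\<close>; such a corner is
  generated by \<open>e\<close> and the remaining \<open>x\<^sub>j, y\<^sub>j\<close> (\<open>j \<in> U\<close>), and the induction is on \<open>U\<close>. In a corner,
  multiplying on the right by a long enough monomial in the \<open>x\<^sub>j\<close> turns any element into a polynomial
  in the \<open>x\<^sub>j\<close>. Hence \<open>a b w = b a w \<in> JI\<close> for some monomial \<open>w\<close>. The letters of \<open>w\<close> are cancelled
  one at a time by \<open>a b = (a b x\<^sub>i) y\<^sub>i + a b p\<^sub>i\<close>. Since \<open>y\<^sub>i\<^sup>k t p\<^sub>i = 0\<close> for large \<open>k\<close>, the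
  remainder \<open>a b p\<^sub>i\<close> reduces to elements \<open>(p\<^sub>i a' p\<^sub>i) (p\<^sub>i b' p\<^sub>i)\<close> of the smaller corner with
  idempotent \<open>e p\<^sub>i\<close>.
\<close>

subsection \<open>Corners of rings generated by one-sided inverses\<close>

text \<open>Elements are built by multiplying \<open>e\<close> on the left by one generator at a
  time, so that induction exposes the leftmost generator. There is no clause for negatives or
  scalars: in the application \<open>G\<close> contains the scalars, and the span of
  \<open>\<one>\<close> is then the whole algebra.\<close>

inductive_set lspan :: "('a, 'b) ring_scheme \<Rightarrow> 'a set \<Rightarrow> 'a \<Rightarrow> 'a set"
  for R (structure) and G e where
  zero: "\<zero> \<in> lspan R G e"
| base: "e \<in> lspan R G e"
| add: "s \<in> lspan R G e \<Longrightarrow> t \<in> lspan R G e \<Longrightarrow> s \<oplus> t \<in> lspan R G e"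
| mult: "a \<in> G \<Longrightarrow> t \<in> lspan R G e \<Longrightarrow> a \<otimes> t \<in> lspan R G e"

inductive_set mult_words :: "('a, 'b) ring_scheme \<Rightarrow> 'a set \<Rightarrow> 'a set"
  for R (structure) and G where
  one: "\<one> \<in> mult_words R G"
| mult: "a \<in> G \<Longrightarrow> w \<in> mult_words R G \<Longrightarrow> a \<otimes> w \<in> mult_words R G"

context ring
begin

lemma lspan_closed:
  assumes "t \<in> lspan R G e" "G \<subseteq> carrier R" "e \<in> carrier R"
  shows "t \<in> carrier R"
  using assms by induction auto

lemma mult_words_closed:
  assumes "w \<in> mult_words R G" "G \<subseteq> carrier R"
  shows "w \<in> carrier R"
  using assms by induction auto

lemma mult_words_mult:
  assumes "v \<in> mult_words R G" "w \<in> mult_words R G" "G \<subseteq> carrier R"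
  shows "v \<otimes> w \<in> mult_words R G"
  using assms
proof induction
  case one
  then show ?case by (simp add: mult_words_closed)
next
  case (mult a v)
  have "(a \<otimes> v) \<otimes> w = a \<otimes> (v \<otimes> w)"
    using mult by (intro m_assoc) (auto dest: mult_words_closed)
  then show ?case
    using mult by (simp add: mult_words.mult)
qed

lemma mult_commutes:
  assumes "z \<otimes> a = a \<otimes> z" "z \<otimes> b = b \<otimes> z"
    "z \<in> carrier R" "a \<in> carrier R" "b \<in> carrier R"
  shows "z \<otimes> (a \<otimes> b) = (a \<otimes> b) \<otimes> z"
  using assms by (metis m_assoc)

lemma pow_commutes:
  assumes "z \<otimes> a = a \<otimes> z" "z \<in> carrier R" "a \<in> carrier R"
  shows "z \<otimes> a [^] (k::nat) = a [^] k \<otimes> z"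
  by (induction k) (use assms in \<open>auto intro: mult_commutes\<close>)

lemma lspan_commutes:
  assumes "t \<in> lspan R G e" "G \<subseteq> carrier R" "e \<in> carrier R" "z \<in> carrier R"
    "\<And>a. a \<in> G \<Longrightarrow> z \<otimes> a = a \<otimes> z" "z \<otimes> e = e \<otimes> z"
  shows "z \<otimes> t = t \<otimes> z"
  using assms(1)
proof induction
  case (add s t)
  then show ?case
    using assms by (simp add: l_distr r_distr lspan_closed)
next
  case (mult a t)
  then show ?case
    using assms by (intro mult_commutes) (auto dest: lspan_closed)
qed (use assms in auto)

lemma mult_words_commutes:
  assumes "w \<in> mult_words R G" "G \<subseteq> carrier R" "z \<in> carrier R"
    "\<And>a. a \<in> G \<Longrightarrow> z \<otimes> a = a \<otimes> z"
  shows "z \<otimes> w = w \<otimes> z"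
  using assms(1)
proof induction
  case (mult a t)
  then show ?case
    using assms by (intro mult_commutes) (auto dest: mult_words_closed)
qed (use assms in auto)

text \<open>A word in \<open>H\<close> commutes with all of \<open>G\<close> and with
  \<open>e\<close>, hence with \<open>t\<close>. It can therefore be moved to the left, where the
  span absorbs it by construction.\<close>

lemma lspan_mult_right:
  assumes "t \<in> lspan R G e" "G \<subseteq> carrier R" "e \<in> carrier R" "w \<in> mult_words R H" "H \<subseteq> G"
    "\<And>a b. a \<in> H \<Longrightarrow> b \<in> G \<Longrightarrow> a \<otimes> b = b \<otimes> a" "\<And>a. a \<in> H \<Longrightarrow> a \<otimes> e = e \<otimes> a"
  shows "t \<otimes> w \<in> lspan R G e"
proof -
  have "w \<otimes> t \<in> lspan R G e"
    using assms(4)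
  proof induction
    case one
    then show ?case using assms lspan_closed by simp
  next
    case (mult a w)
    have "(a \<otimes> w) \<otimes> t = a \<otimes> (w \<otimes> t)"
      using mult assms by (intro m_assoc) (auto intro: lspan_closed mult_words_closed)
    then show ?case using mult assms by (auto intro: lspan.mult)
  qed
  moreover have H: "H \<subseteq> carrier R" using assms by blast
  have "t \<otimes> w = w \<otimes> t"
  proof (rule mult_words_commutes)
    fix a assume "a \<in> H"
    then have "a \<otimes> t = t \<otimes> a"
      using assms H by (intro lspan_commutes[of t G e]) auto
    then show "t \<otimes> a = a \<otimes> t" ..
  qed (use assms H lspan_closed in auto)
  ultimately show ?thesis by simp
qed

end

section \<open>Several commuting pairs of one-sided inverses, and the idempotents
  \<open>p i\<close>\<close>

text \<open>An abstract form of the algebra with index set \<open>N\<close>, where \<open>C\<close>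
  stands for the image of the scalars. Only the relations are axioms here; generation by
  \<open>C\<close>, the \<open>x i\<close> and the \<open>y i\<close> is assumed later, where it
  enters through the corners.\<close>

locale one_sided_inverses = ring +
  fixes C :: "'a set" and x y :: "'i \<Rightarrow> 'a" and N :: "'i set"
  assumes C_closed: "C \<subseteq> carrier R"
    and C_central: "c \<in> C \<Longrightarrow> s \<in> carrier R \<Longrightarrow> c \<otimes> s = s \<otimes> c"
    and x_closed: "i \<in> N \<Longrightarrow> x i \<in> carrier R"
    and y_closed: "i \<in> N \<Longrightarrow> y i \<in> carrier R"
    and yx: "i \<in> N \<Longrightarrow> y i \<otimes> x i = \<one>"
    and xx: "i \<in> N \<Longrightarrow> j \<in> N \<Longrightarrow> x i \<otimes> x j = x j \<otimes> x i"
    and yy: "i \<in> N \<Longrightarrow> j \<in> N \<Longrightarrow> y i \<otimes> y j = y j \<otimes> y i"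
    and xy: "i \<in> N \<Longrightarrow> j \<in> N \<Longrightarrow> i \<noteq> j \<Longrightarrow> x i \<otimes> y j = y j \<otimes> x i"
begin

text \<open>In the model where \<open>x i\<close> is multiplication by a variable and
  \<open>y i\<close> the backward shift, \<open>p i\<close> is the projection onto the polynomials
  free of that variable.\<close>

definition p :: "'i \<Rightarrow> 'a" where
  "p i = \<one> \<ominus> x i \<otimes> y i"

definition gen_set :: "'i set \<Rightarrow> 'a set" where
  "gen_set U = C \<union> x ` U \<union> y ` U"

lemma gen_set_closed: "U \<subseteq> N \<Longrightarrow> gen_set U \<subseteq> carrier R"
  using C_closed x_closed y_closed by (auto simp: gen_set_def)

lemma p_closed: "i \<in> N \<Longrightarrow> p i \<in> carrier R"
  by (simp add: p_def x_closed y_closed)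

lemma yp: "i \<in> N \<Longrightarrow> y i \<otimes> p i = \<zero>"
proof -
  assume i: "i \<in> N"
  note [simp] = x_closed[OF i] y_closed[OF i]
  have "y i \<otimes> p i = y i \<ominus> (y i \<otimes> x i) \<otimes> y i"
    by (simp add: p_def a_minus_def r_distr r_minus m_assoc)
  then show ?thesis by (simp add: yx i a_minus_def r_neg)
qed

lemma px: "i \<in> N \<Longrightarrow> p i \<otimes> x i = \<zero>"
proof -
  assume i: "i \<in> N"
  note [simp] = x_closed[OF i] y_closed[OF i]
  have "p i \<otimes> x i = x i \<ominus> x i \<otimes> (y i \<otimes> x i)"
    by (simp add: p_def a_minus_def l_distr l_minus m_assoc)
  then show ?thesis by (simp add: yx i a_minus_def r_neg)
qed

lemma p_idem: "i \<in> N \<Longrightarrow> p i \<otimes> p i = p i"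
proof -
  assume i: "i \<in> N"
  note [simp] = x_closed[OF i] y_closed[OF i] p_closed[OF i]
  have "p i \<otimes> p i = p i \<ominus> (p i \<otimes> x i) \<otimes> y i"
    by (subst (2) p_def) (simp add: a_minus_def r_distr r_minus m_assoc)
  then show ?thesis by (simp add: px i a_minus_def)
qed

lemma p_commutes:
  assumes "i \<in> N" "z \<in> carrier R" "z \<otimes> x i = x i \<otimes> z" "z \<otimes> y i = y i \<otimes> z"
  shows "z \<otimes> p i = p i \<otimes> z"
proof -
  have "z \<otimes> (x i \<otimes> y i) = (x i \<otimes> y i) \<otimes> z"
    using assms by (simp add: mult_commutes x_closed y_closed)
  then show ?thesis
    using assms by (simp add: p_def a_minus_def l_distr r_distr l_minus r_minus x_closed y_closed)
qed

lemma split_left: "i \<in> N \<Longrightarrow> s \<in> carrier R \<Longrightarrow> s = x i \<otimes> (y i \<otimes> s) \<oplus> p i \<otimes> s"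
  by (simp add: p_def a_minus_def l_distr l_minus m_assoc x_closed y_closed)
    (metis a_comm add.inv_closed m_closed r_neg r_zero a_assoc x_closed y_closed)

lemma split_right: "i \<in> N \<Longrightarrow> s \<in> carrier R \<Longrightarrow> s = s \<otimes> x i \<otimes> y i \<oplus> s \<otimes> p i"
  by (simp add: p_def a_minus_def r_distr r_minus m_assoc x_closed y_closed)
    (metis a_comm add.inv_closed m_closed r_neg r_zero a_assoc x_closed y_closed)

text \<open>Powers of \<open>y i\<close> are pushed to the right through \<open>t\<close>. They
  commute with \<open>e\<close> and with every generator except \<open>x i\<close>; each
  \<open>x i\<close> consumes one power, and a \<open>y i\<close> that reaches \<open>p i\<close>
  gives zero.\<close>

lemma y_pow_kills_p:
  assumes t: "t \<in> lspan R (gen_set U) e" and U: "U \<subseteq> N" and i: "i \<in> U" and e: "e \<in> carrier R"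
    and ex: "e \<otimes> x i = x i \<otimes> e" and ey: "e \<otimes> y i = y i \<otimes> e"
  shows "\<exists>k::nat. y i [^] k \<otimes> (t \<otimes> p i) = \<zero>"
  using t
proof induction
  have iN: "i \<in> N" using i U by blast
  note [simp] = x_closed[OF iN] y_closed[OF iN] p_closed[OF iN] e
  have G: "gen_set U \<subseteq> carrier R" using U by (rule gen_set_closed)
  {
    case zero
    then show ?case by simp
  next
    case base
    have "y i \<otimes> (e \<otimes> p i) = e \<otimes> (y i \<otimes> p i)"
      by (metis ey m_assoc e \<open>y i \<in> carrier R\<close> \<open>p i \<in> carrier R\<close>)
    then have "y i [^] (1::nat) \<otimes> (e \<otimes> p i) = \<zero>" by (simp add: yp iN)
    then show ?case by blast
  next
    case (add s t)
    then obtain k l :: nat where kl: "y i [^] k \<otimes> (s \<otimes> p i) = \<zero>" "y i [^] l \<otimes> (t \<otimes> p i) = \<zero>"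
      by blast
    have [simp]: "s \<in> carrier R" "t \<in> carrier R"
      using add G by (auto intro: lspan_closed)
    have "y i [^] (l + k) \<otimes> (s \<otimes> p i) = y i [^] l \<otimes> (y i [^] k \<otimes> (s \<otimes> p i))"
      by (simp add: nat_pow_mult[symmetric] m_assoc)
    moreover have "y i [^] (k + l) \<otimes> (t \<otimes> p i) = y i [^] k \<otimes> (y i [^] l \<otimes> (t \<otimes> p i))"
      by (simp add: nat_pow_mult[symmetric] m_assoc)
    ultimately have "y i [^] (k + l) \<otimes> ((s \<oplus> t) \<otimes> p i) = \<zero>"
      by (simp add: kl l_distr r_distr add.commute[of l k])
    then show ?case by blast
  next
    case (mult a t)
    then obtain k :: nat where k: "y i [^] k \<otimes> (t \<otimes> p i) = \<zero>" by blast
    have [simp]: "a \<in> carrier R" "t \<in> carrier R"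
      using mult G by (auto intro: lspan_closed)
    have comm: ?case if "a \<otimes> y i = y i \<otimes> a"
    proof -
      have "y i [^] k \<otimes> (a \<otimes> t \<otimes> p i) = (y i [^] k \<otimes> a) \<otimes> (t \<otimes> p i)"
        by (simp add: m_assoc)
      also have "\<dots> = (a \<otimes> y i [^] k) \<otimes> (t \<otimes> p i)"
        using that by (simp add: pow_commutes)
      also have "\<dots> = \<zero>"
        by (simp add: m_assoc k)
      finally show ?thesis by blast
    qed
    consider "a \<in> C" | j where "j \<in> U" "a = x j" | j where "j \<in> U" "a = y j"
      using mult.hyps by (auto simp: gen_set_def)
    then show ?case
    proof cases
      case 1
      then show ?thesis by (intro comm C_central) simp_all
    next
      case 2
      show ?thesis
      proof (cases "j = i")
        case True
        \<comment> \<open>The additional innermost \<open>y i\<close> cancels the new leftmost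
          factor \<open>x i\<close>, after which the exponent for \<open>t\<close> suffices.\<close>
        have "y i [^] Suc k \<otimes> (a \<otimes> t \<otimes> p i) = y i [^] k \<otimes> ((y i \<otimes> x i) \<otimes> (t \<otimes> p i))"
          using True 2 by (simp add: m_assoc)
        then have "y i [^] Suc k \<otimes> (a \<otimes> t \<otimes> p i) = \<zero>"
          by (simp add: yx iN k del: nat_pow_Suc)
        then show ?thesis by blast
      next
        case False
        then show ?thesis using 2 U iN by (intro comm) (auto intro: xy)
      qed
    next
      case 3
      then show ?thesis using U iN by (intro comm) (auto intro: yy)
    qed
  }
qed

text \<open>The case \<open>k = 0\<close> is the one wanted: it shows that compressing by
  \<open>p i\<close> removes \<open>x i\<close> and \<open>y i\<close> from the generators. The
  power of \<open>y i\<close> makes the induction work: a leading \<open>y i\<close> raises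
  \<open>k\<close>, a leading \<open>x i\<close> lowers it or is killed by \<open>p i\<close> when
  \<open>k = 0\<close>, and every other generator passes to the front.\<close>

lemma corner_step:
  assumes t: "t \<in> lspan R (gen_set U) e" and U: "U \<subseteq> N" and i: "i \<in> U" and e: "e \<in> carrier R"
    and ex: "\<And>j. j \<in> U \<Longrightarrow> e \<otimes> x j = x j \<otimes> e" and ey: "\<And>j. j \<in> U \<Longrightarrow> e \<otimes> y j = y j \<otimes> e"
  shows "p i \<otimes> (y i [^] (k::nat) \<otimes> (t \<otimes> p i)) \<in> lspan R (gen_set (U - {i})) (e \<otimes> p i)"
  using t
proof (induction arbitrary: k)
  have iN: "i \<in> N" using i U by blast
  note [simp] = x_closed[OF iN] y_closed[OF iN] p_closed[OF iN] e
  have G: "gen_set U \<subseteq> carrier R" using U by (rule gen_set_closed)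
  have ep: "e \<otimes> p i = p i \<otimes> e" using i ex ey iN by (intro p_commutes) auto
  {
    case zero
    then show ?case by (simp add: lspan.zero)
  next
    case base
    show ?case
    proof (cases k)
      case 0
      have "p i \<otimes> (e \<otimes> p i) = e \<otimes> (p i \<otimes> p i)"
        using ep by (metis m_assoc e \<open>p i \<in> carrier R\<close>)
      then show ?thesis using 0 by (simp add: p_idem iN lspan.base)
    next
      case (Suc l)
      have "y i [^] k \<otimes> (e \<otimes> p i) = y i [^] l \<otimes> ((y i \<otimes> e) \<otimes> p i)"
        using Suc by (simp add: m_assoc)
      also have "(y i \<otimes> e) \<otimes> p i = e \<otimes> (y i \<otimes> p i)"
        using ey i by (simp add: m_assoc[symmetric])
      finally show ?thesis by (simp add: yp iN lspan.zero)
    qed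
  next
    case (add s t)
    have [simp]: "s \<in> carrier R" "t \<in> carrier R"
      using add G by (auto intro: lspan_closed)
    show ?case using add.IH by (simp add: l_distr r_distr lspan.add)
  next
    case (mult a t)
    have [simp]: "a \<in> carrier R" "t \<in> carrier R"
      using mult G by (auto intro: lspan_closed)
    have comm: ?case if a: "a \<otimes> y i = y i \<otimes> a" "a \<otimes> p i = p i \<otimes> a" "a \<in> gen_set (U - {i})"
    proof -
      have "p i \<otimes> (y i [^] k \<otimes> (a \<otimes> t \<otimes> p i)) = p i \<otimes> ((y i [^] k \<otimes> a) \<otimes> (t \<otimes> p i))"
        by (simp add: m_assoc)
      also have "\<dots> = p i \<otimes> ((a \<otimes> y i [^] k) \<otimes> (t \<otimes> p i))"
        using a by (simp add: pow_commutes)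
      also have "\<dots> = (p i \<otimes> a) \<otimes> (y i [^] k \<otimes> (t \<otimes> p i))"
        by (simp add: m_assoc)
      also have "\<dots> = a \<otimes> (p i \<otimes> (y i [^] k \<otimes> (t \<otimes> p i)))"
        using a by (simp add: m_assoc flip: a(2))
      finally show ?thesis using a mult.IH by (simp add: lspan.mult)
    qed
    consider "a \<in> C" | j where "j \<in> U" "a = x j" | j where "j \<in> U" "a = y j"
      using mult.hyps by (auto simp: gen_set_def)
    then show ?case
    proof cases
      case 1
      then show ?thesis by (intro comm C_central) (simp_all add: gen_set_def)
    next
      case 2
      show ?thesis
      proof (cases "j = i")
        case True
        show ?thesis
        proof (cases k)
          case 0
          have "p i \<otimes> (y i [^] k \<otimes> (a \<otimes> t \<otimes> p i)) = (p i \<otimes> x i) \<otimes> (t \<otimes> p i)"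
            using 0 2 True by (simp add: m_assoc)
          then show ?thesis by (simp add: px iN lspan.zero)
        next
          case (Suc l)
          have "y i [^] k \<otimes> (a \<otimes> t \<otimes> p i) = y i [^] l \<otimes> ((y i \<otimes> x i) \<otimes> (t \<otimes> p i))"
            using Suc 2 True by (simp add: m_assoc)
          then show ?thesis using mult.IH[of l] by (simp add: yx iN)
        qed
      next
        case False
        then show ?thesis using 2 U iN
          by (intro comm p_commutes) (auto intro: xy xx x_closed simp: gen_set_def)
      qed
    next
      case 3
      show ?thesis
      proof (cases "j = i")
        case True
        have "y i [^] k \<otimes> (a \<otimes> t \<otimes> p i) = y i [^] Suc k \<otimes> (t \<otimes> p i)"
          using 3 True by (simp add: m_assoc)
        then show ?thesis using mult.IH[of "Suc k"] by simp
      next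
        case False
        then show ?thesis using 3 U iN
          by (intro comm p_commutes) (auto intro: yy y_closed simp: xy[symmetric] gen_set_def)
      qed
    qed
  }
qed

section \<open>Commutation after multiplying by a monomial\<close>

text \<open>Each leading \<open>y j\<close> is paid for by one more letter \<open>x j\<close> in the
  word. What remains is a polynomial in the \<open>x j\<close> with coefficients from
  \<open>C\<close>, times \<open>e\<close>.\<close>

lemma mult_word_in_polys:
  assumes t: "t \<in> lspan R (gen_set U) e" and U: "U \<subseteq> N" and e: "e \<in> carrier R"
    and ex: "\<And>j. j \<in> U \<Longrightarrow> e \<otimes> x j = x j \<otimes> e"
  shows "\<exists>w \<in> mult_words R (x ` U). t \<otimes> w \<in> lspan R (C \<union> x ` U) e"
  using t
proof induction
  have G: "gen_set U \<subseteq> carrier R" using U by (rule gen_set_closed)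
  have X: "x ` U \<subseteq> carrier R" "C \<union> x ` U \<subseteq> carrier R" using U x_closed C_closed by auto
  have right: "t \<otimes> w \<in> lspan R (C \<union> x ` U) e"
    if "t \<in> lspan R (C \<union> x ` U) e" "w \<in> mult_words R (x ` U)" for t w
  proof (rule lspan_mult_right[OF that(1) X(2) e that(2)])
    show "a \<otimes> b = b \<otimes> a" if "a \<in> x ` U" "b \<in> C \<union> x ` U" for a b
      using that X U by (auto intro: xx C_central C_central[symmetric])
  qed (auto simp: ex)
  {
    case zero
    then show ?case using lspan.zero mult_words.one by force
  next
    case base
    then show ?case using lspan.base mult_words.one e by (metis r_one)
  next
    case (add s t)
    then obtain v w where vw: "v \<in> mult_words R (x ` U)" "w \<in> mult_words R (x ` U)"
      "s \<otimes> v \<in> lspan R (C \<union> x ` U) e" "t \<otimes> w \<in> lspan R (C \<union> x ` U) e" by blast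
    have [simp]: "s \<in> carrier R" "t \<in> carrier R" "v \<in> carrier R" "w \<in> carrier R"
      using add G vw X e by (auto intro: lspan_closed mult_words_closed)
    have wv: "w \<otimes> v = v \<otimes> w"
    proof (rule mult_words_commutes[OF vw(1) X(1)])
      fix a assume "a \<in> x ` U"
      then have "a \<otimes> w = w \<otimes> a"
        using U X by (intro mult_words_commutes[OF vw(2)]) (auto intro: xx)
      then show "w \<otimes> a = a \<otimes> w" ..
    qed simp
    \<comment> \<open>The product of the two words serves both summands, since polynomials remain
      polynomials under further multiplication by a word.\<close>
    have "(s \<oplus> t) \<otimes> (v \<otimes> w) = (s \<otimes> v) \<otimes> w \<oplus> (t \<otimes> w) \<otimes> v"
      by (simp add: l_distr m_assoc wv)
    also have "\<dots> \<in> lspan R (C \<union> x ` U) e"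
      by (intro lspan.add right[OF vw(3,2)] right[OF vw(4,1)])
    finally show ?case using vw X mult_words_mult by blast
  next
    case (mult a t)
    then obtain w where w: "w \<in> mult_words R (x ` U)" "t \<otimes> w \<in> lspan R (C \<union> x ` U) e"
      by blast
    have [simp]: "a \<in> carrier R" "t \<in> carrier R" "w \<in> carrier R"
      using mult G w X e by (auto intro: lspan_closed mult_words_closed)
    show ?case
    proof (cases "a \<in> C \<union> x ` U")
      case True
      then have "a \<otimes> t \<otimes> w \<in> lspan R (C \<union> x ` U) e"
        using w by (simp add: m_assoc lspan.mult)
      then show ?thesis using w by blast
    next
      case False
      then obtain j where j: "j \<in> U" "a = y j" using mult.hyps by (auto simp: gen_set_def)
      then have jN: "j \<in> N" using U by blast
      note [simp] = x_closed[OF jN] y_closed[OF jN]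
      have xc: "x j \<otimes> (t \<otimes> w) = (t \<otimes> w) \<otimes> x j"
        using j X U ex e by (intro lspan_commutes[OF w(2)]) (auto intro: xx C_central C_central[symmetric])
      have xw: "x j \<otimes> w = w \<otimes> x j"
        using j X U by (intro mult_words_commutes[OF w(1)]) (auto intro: xx)
      \<comment> \<open>As \<open>t \<otimes> w\<close> is already a polynomial, the new letter
        \<open>x j\<close> can travel through it to the left and meet \<open>y j\<close>.\<close>
      have "a \<otimes> t \<otimes> (x j \<otimes> w) = y j \<otimes> (t \<otimes> w \<otimes> x j)"
        using j xw by (simp add: m_assoc)
      also have "\<dots> = (y j \<otimes> x j) \<otimes> (t \<otimes> w)"
        by (simp add: m_assoc flip: xc)
      also have "\<dots> = t \<otimes> w" by (simp add: yx jN)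
      finally show ?thesis using w j mult_words.mult[of "x j" "x ` U" w R]
        by (auto intro!: bexI[of _ "x j \<otimes> w"])
    qed
  }
qed

text \<open>Suitable words turn \<open>s\<close> and \<open>t\<close> into polynomials, which
  commute with each other and with all words. The product of the two words then works for both
  orders of the factors.\<close>

lemma corner_commute_up_to_word:
  assumes s: "s \<in> lspan R (gen_set U) e" and t: "t \<in> lspan R (gen_set U) e"
    and U: "U \<subseteq> N" and e: "e \<in> carrier R"
    and ex: "\<And>j. j \<in> U \<Longrightarrow> e \<otimes> x j = x j \<otimes> e"
  shows "\<exists>w \<in> mult_words R (x ` U). s \<otimes> t \<otimes> w = t \<otimes> s \<otimes> w"
proof -
  have G: "gen_set U \<subseteq> carrier R" using U by (rule gen_set_closed)
  have X: "x ` U \<subseteq> carrier R" "C \<union> x ` U \<subseteq> carrier R" using U x_closed C_closed by auto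
  obtain v w where v: "v \<in> mult_words R (x ` U)" "s \<otimes> v \<in> lspan R (C \<union> x ` U) e"
    and w: "w \<in> mult_words R (x ` U)" "t \<otimes> w \<in> lspan R (C \<union> x ` U) e"
    using mult_word_in_polys[OF s U e ex] mult_word_in_polys[OF t U e ex] by blast
  have [simp]: "s \<in> carrier R" "t \<in> carrier R" "v \<in> carrier R" "w \<in> carrier R"
    using s t v w G X e by (auto intro: lspan_closed mult_words_closed)
  have word_comm: "f \<otimes> u = u \<otimes> f"
    if f: "f \<in> lspan R (C \<union> x ` U) e" and u: "u \<in> mult_words R (x ` U)" for f u
  proof (rule mult_words_commutes[OF u X(1)])
    fix a assume "a \<in> x ` U"
    then have "a \<otimes> f = f \<otimes> a"
      using X U ex e by (intro lspan_commutes[OF f]) (auto intro: xx C_central C_central[symmetric])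
    then show "f \<otimes> a = a \<otimes> f" ..
  qed (use f X e lspan_closed in auto)
  have poly_comm: "f \<otimes> g = g \<otimes> f"
    if f: "f \<in> lspan R (C \<union> x ` U) e" and g: "g \<in> lspan R (C \<union> x ` U) e" for f g
  proof (rule lspan_commutes[OF g X(2) e])
    show f': "f \<in> carrier R" using f X e lspan_closed by auto
    show "f \<otimes> a = a \<otimes> f" if "a \<in> C \<union> x ` U" for a
    proof -
      have "a \<otimes> f = f \<otimes> a"
      proof (cases "a \<in> C")
        case True
        then show ?thesis using f' by (rule C_central)
      next
        case False
        then show ?thesis
          using that X U ex e by (intro lspan_commutes[OF f]) (auto intro: xx C_central[symmetric])
      qed
      then show ?thesis ..
    qed
    have "e \<otimes> f = f \<otimes> e"
      using X U ex e by (intro lspan_commutes[OF f]) (auto intro: C_central[symmetric])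
    then show "f \<otimes> e = e \<otimes> f" ..
  qed
  have "w \<otimes> v = v \<otimes> w"
  proof (rule mult_words_commutes[OF v(1) X(1)])
    fix a assume "a \<in> x ` U"
    then have "a \<otimes> w = w \<otimes> a"
      using U X by (intro mult_words_commutes[OF w(1)]) (auto intro: xx)
    then show "w \<otimes> a = a \<otimes> w" ..
  qed simp
  then have "t \<otimes> s \<otimes> (w \<otimes> v) = t \<otimes> ((s \<otimes> v) \<otimes> w)"
    by (simp add: m_assoc)
  also have "\<dots> = (t \<otimes> w) \<otimes> (s \<otimes> v)"
    using word_comm[OF v(2) w(1)] by (simp add: m_assoc)
  also have "\<dots> = (s \<otimes> v) \<otimes> (t \<otimes> w)"
    by (rule poly_comm) fact+
  also have "\<dots> = s \<otimes> ((t \<otimes> w) \<otimes> v)"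
    using word_comm[OF w(2) v(1)] by (simp add: m_assoc)
  also have "\<dots> = s \<otimes> t \<otimes> (w \<otimes> v)"
    by (simp add: m_assoc)
  finally show ?thesis using v w X mult_words_mult by metis
qed

section \<open>Products of ideal elements in a corner, by induction on the remaining indices\<close>

text \<open>The ideal \<open>K\<close> will be \<open>J \<cdot> I\<close>, but only the property
  \<open>JIK\<close> is used. The idempotent \<open>e\<close> varies in the induction, as passing to
  fewer indices replaces it by \<open>e \<otimes> p i\<close>. No separate base case occurs: for
  empty \<open>U\<close> the only word is \<open>\<one>\<close>, so the two factors commute.\<close>

lemma corner_prod_mem:
  assumes "finite U" "U \<subseteq> N" "e \<in> carrier R" "e \<otimes> e = e"
    and "\<And>j. j \<in> U \<Longrightarrow> e \<otimes> x j = x j \<otimes> e" "\<And>j. j \<in> U \<Longrightarrow> e \<otimes> y j = y j \<otimes> e"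
    and "\<And>s. s \<in> carrier R \<Longrightarrow> e \<otimes> s \<otimes> e \<in> lspan R (gen_set U) e"
    and I: "ideal I R" and J: "ideal J R" and K: "ideal K R"
    and JIK: "\<And>a b. a \<in> I \<Longrightarrow> b \<in> J \<Longrightarrow> b \<otimes> a \<in> K"
    and "a \<in> I" "b \<in> J"
  shows "(e \<otimes> a \<otimes> e) \<otimes> (e \<otimes> b \<otimes> e) \<in> K"
  using assms(1-7,12,13)
proof (induction U arbitrary: e a b rule: finite_psubset_induct)
  case (psubset U)
  note U = psubset.prems(1) and e [simp] = psubset.prems(2) and ee = psubset.prems(3)
    and ex = psubset.prems(4) and ey = psubset.prems(5) and cor = psubset.prems(6)
  note [simp] = ideal.Icarr[OF I] ideal.Icarr[OF J] ideal.Icarr[OF K]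
  note I_mult = ideal.I_l_closed[OF I] ideal.I_r_closed[OF I]
  note J_mult = ideal.I_l_closed[OF J] ideal.I_r_closed[OF J]
  note K_mult = ideal.I_l_closed[OF K] ideal.I_r_closed[OF K]
  note K_add = additive_subgroup.a_closed[OF ideal.axioms(1)[OF K]]
  note K_zero = additive_subgroup.zero_closed[OF ideal.axioms(1)[OF K]]
  \<comment> \<open>This is the corner \<open>e R e\<close>, described by equations so that closure
    under elements commuting with \<open>e\<close> is immediate.\<close>
  define E where "E = {s \<in> carrier R. e \<otimes> s = s \<and> s \<otimes> e = s}"
  have E_closed: "s \<in> carrier R" and eE: "e \<otimes> s = s" and Ee: "s \<otimes> e = s" if "s \<in> E" for s
    using that by (auto simp: E_def)
  have E_corner: "e \<otimes> s \<otimes> e \<in> E" if "s \<in> carrier R" for s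
  proof -
    have "e \<otimes> (e \<otimes> s \<otimes> e) = e \<otimes> e \<otimes> s \<otimes> e" "e \<otimes> s \<otimes> e \<otimes> e = e \<otimes> s \<otimes> (e \<otimes> e)"
      using that by (simp_all add: m_assoc)
    then show ?thesis using that by (simp add: E_def ee)
  qed
  have E_lspan: "s \<in> lspan R (gen_set U) e" if "s \<in> E" for s
    using cor[of s] that by (simp add: E_def)
  have E_mult: "s \<otimes> g \<in> E" "g \<otimes> s \<in> E" if "s \<in> E" "g \<in> carrier R" "e \<otimes> g = g \<otimes> e" for s g
  proof -
    note [simp] = E_closed[OF that(1)] that(2)
    have "e \<otimes> (s \<otimes> g) = e \<otimes> s \<otimes> g" "s \<otimes> g \<otimes> e = s \<otimes> e \<otimes> g"
      "e \<otimes> (g \<otimes> s) = g \<otimes> (e \<otimes> s)" "g \<otimes> s \<otimes> e = g \<otimes> (s \<otimes> e)"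
      using that(3) by (simp_all add: m_assoc flip: that(3)) (simp_all add: that(3) flip: m_assoc)
    then show "s \<otimes> g \<in> E" "g \<otimes> s \<in> E"
      using that by (simp_all add: E_def)
  qed
  \<comment> \<open>The claim is reached in three stages: first with both factors compressed by
    \<open>p i\<close> (\<open>pp\<close>), then with only \<open>b\<close> compressed
    (\<open>a_pbp\<close>), and finally with just the \<open>p i\<close> on the right.\<close>
  have ab_p: "a \<otimes> b \<otimes> p i \<in> K" if i: "i \<in> U" and ab: "a \<in> I" "b \<in> J" "a \<in> E" "b \<in> E" for a b i
  proof -
    have iN: "i \<in> N" using i U by blast
    note [simp] = x_closed[OF iN] y_closed[OF iN] p_closed[OF iN]
    have ep: "e \<otimes> p i = p i \<otimes> e" using i ex ey iN by (intro p_commutes) auto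
    \<comment> \<open>The idempotent of the smaller corner. It still commutes with
      \<open>x j\<close> and \<open>y j\<close> for the other indices \<open>j\<close>, and on
      elements of \<open>E\<close> compression by \<open>f\<close> agrees with compression by
      \<open>p i\<close>.\<close>
    define f where "f = e \<otimes> p i"
    have [simp]: "f \<in> carrier R" by (simp add: f_def)
    have ff: "f \<otimes> f = f"
    proof -
      have "f \<otimes> f = e \<otimes> (p i \<otimes> e) \<otimes> p i" by (simp add: f_def m_assoc)
      also have "\<dots> = (e \<otimes> e) \<otimes> (p i \<otimes> p i)" by (simp add: m_assoc flip: ep)
      finally show ?thesis by (simp add: ee p_idem iN f_def)
    qed
    have fsf: "f \<otimes> s \<otimes> f = p i \<otimes> (e \<otimes> s \<otimes> e \<otimes> p i)" if "s \<in> carrier R" for s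
    proof -
      have "f \<otimes> s \<otimes> f = (p i \<otimes> e) \<otimes> s \<otimes> (e \<otimes> p i)" by (simp add: f_def flip: ep)
      then show ?thesis using that by (simp add: m_assoc)
    qed
    have pp: "(p i \<otimes> a \<otimes> p i) \<otimes> (p i \<otimes> b \<otimes> p i) \<in> K"
      if "a \<in> I" "b \<in> J" "a \<in> E" "b \<in> E" for a b
    proof -
      have "(f \<otimes> a \<otimes> f) \<otimes> (f \<otimes> b \<otimes> f) \<in> K"
      proof (rule psubset.IH[of "U - {i}"])
        show "U - {i} \<subset> U" "U - {i} \<subseteq> N" using i U by auto
        show "f \<otimes> x j = x j \<otimes> f" if "j \<in> U - {i}" for j
        proof -
          have j: "j \<in> N" "j \<noteq> i" "x j \<in> carrier R" using that U x_closed by auto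
          then have "x j \<otimes> p i = p i \<otimes> x j"
            using iN by (intro p_commutes) (auto intro: xx xy)
          moreover have "x j \<otimes> e = e \<otimes> x j" using ex that by simp
          ultimately show ?thesis using j unfolding f_def by (metis mult_commutes e p_closed iN)
        qed
        show "f \<otimes> y j = y j \<otimes> f" if "j \<in> U - {i}" for j
        proof -
          have j: "j \<in> N" "j \<noteq> i" "y j \<in> carrier R" using that U y_closed by auto
          then have "y j \<otimes> p i = p i \<otimes> y j"
            using iN by (intro p_commutes) (auto intro: yy simp: xy[symmetric])
          moreover have "y j \<otimes> e = e \<otimes> y j" using ey that by simp
          ultimately show ?thesis using j unfolding f_def by (metis mult_commutes e p_closed iN)
        qed
        show "f \<otimes> s \<otimes> f \<in> lspan R (gen_set (U - {i})) f" if "s \<in> carrier R" for s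
          using corner_step[OF cor[OF that] U i e ex ey, of 0] that fsf[OF that]
          by (simp add: f_def)
      qed (use that ff in auto)
      moreover have "f \<otimes> s \<otimes> f = p i \<otimes> s \<otimes> p i" if "s \<in> E" for s
        using that fsf[of s] by (simp add: E_closed eE Ee m_assoc)
      ultimately show ?thesis using that by simp
    qed
    have a_pbp: "a \<otimes> (p i \<otimes> b \<otimes> p i) \<in> K"
      if a: "a \<in> I" "a \<in> E" and b: "b \<in> J" "b \<in> E" for a b
    proof -
      obtain k :: nat where k: "y i [^] k \<otimes> (a \<otimes> p i) = \<zero>"
        using y_pow_kills_p[OF E_lspan[OF a(2)] U i e ex[OF i] ey[OF i]] by blast
      \<comment> \<open>Replacing \<open>a\<close> by \<open>y i \<otimes> a\<close> stays in
        \<open>I\<close> and in \<open>E\<close> and lowers the exponent by one. At exponent zero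
        \<open>a \<otimes> p i\<close> itself vanishes.\<close>
      show ?thesis using k a
      proof (induction k arbitrary: a)
        case 0
        have *: "a \<otimes> (p i \<otimes> b \<otimes> p i) = (a \<otimes> p i) \<otimes> (p i \<otimes> b \<otimes> p i)"
        proof -
          have "(a \<otimes> p i) \<otimes> (p i \<otimes> b \<otimes> p i) = a \<otimes> ((p i \<otimes> p i) \<otimes> b \<otimes> p i)"
            using b "0.prems"(2) by (simp add: m_assoc)
          then show ?thesis by (simp add: p_idem iN)
        qed
        show ?case using 0 b by (simp add: * K_zero)
      next
        case (Suc k)
        have [simp]: "a \<in> carrier R" "b \<in> carrier R" using Suc b by auto
        have ya: "y i \<otimes> a \<in> I" "y i \<otimes> a \<in> E"
          using Suc ey i by (auto intro: I_mult E_mult)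
        have "y i [^] k \<otimes> (y i \<otimes> a \<otimes> p i) = \<zero>"
          using Suc.prems(1) by (simp add: m_assoc)
        then have 1: "y i \<otimes> a \<otimes> (p i \<otimes> b \<otimes> p i) \<in> K"
          using Suc.IH ya by blast
        \<comment> \<open>Doubling the idempotent in front of \<open>b\<close> leaves one copy to
          complete \<open>p i \<otimes> a\<close> to \<open>p i \<otimes> a \<otimes> p i\<close>.
          The first summand is then covered by the induction on \<open>k\<close>, the second by
          \<open>pp\<close>.\<close>
        have "a \<otimes> (p i \<otimes> b \<otimes> p i) = (x i \<otimes> (y i \<otimes> a) \<oplus> p i \<otimes> a) \<otimes> ((p i \<otimes> p i) \<otimes> b \<otimes> p i)"
          by (subst split_left[OF iN, of a]) (simp_all add: p_idem iN)
        also have "\<dots> = x i \<otimes> (y i \<otimes> a \<otimes> ((p i \<otimes> p i) \<otimes> b \<otimes> p i)) \<oplus> (p i \<otimes> a \<otimes> p i) \<otimes> (p i \<otimes> b \<otimes> p i)"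
          by (simp add: l_distr m_assoc)
        finally show ?case
          using 1 pp[OF Suc.prems(2) b(1) Suc.prems(3) b(2)]
          by (simp add: p_idem iN K_add K_mult)
      qed
    qed
    obtain k :: nat where k: "y i [^] k \<otimes> (b \<otimes> p i) = \<zero>"
      using y_pow_kills_p[OF E_lspan[OF ab(4)] U i e ex[OF i] ey[OF i]] by blast
    \<comment> \<open>The same descent, now on \<open>b\<close>: the \<open>x i\<close> split off
      from \<open>b\<close> is absorbed into \<open>a\<close>, so both must vary. The remaining
      summand is of the form treated in \<open>a_pbp\<close>.\<close>
    show ?thesis using k ab
    proof (induction k arbitrary: a b)
      case 0
      then show ?case by (simp add: m_assoc K_zero)
    next
      case (Suc k)
      have [simp]: "a \<in> carrier R" "b \<in> carrier R" using Suc by auto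
      have yb: "y i \<otimes> b \<in> J" "y i \<otimes> b \<in> E"
        using Suc ey i by (auto intro: J_mult E_mult)
      have ax: "a \<otimes> x i \<in> I" "a \<otimes> x i \<in> E"
        using Suc ex i by (auto intro: I_mult E_mult)
      have "y i [^] k \<otimes> (y i \<otimes> b \<otimes> p i) = \<zero>"
        using Suc.prems(1) by (simp add: m_assoc)
      then have 1: "a \<otimes> x i \<otimes> (y i \<otimes> b) \<otimes> p i \<in> K"
        using Suc.IH yb ax by blast
      have "a \<otimes> b \<otimes> p i = a \<otimes> (x i \<otimes> (y i \<otimes> b) \<oplus> p i \<otimes> b) \<otimes> p i"
        by (subst split_left[OF iN, of b]) simp_all
      also have "\<dots> = a \<otimes> x i \<otimes> (y i \<otimes> b) \<otimes> p i \<oplus> a \<otimes> (p i \<otimes> b \<otimes> p i)"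
        by (simp add: l_distr r_distr m_assoc)
      finally show ?case
        using 1 a_pbp[OF Suc.prems(2,4,3,5)] by (simp add: K_add)
    qed
  qed
  \<comment> \<open>The first letter of the word is absorbed into \<open>b\<close>, which is
    therefore kept arbitrary. To return from \<open>b \<otimes> x i\<close> to \<open>b\<close>,
    multiply by \<open>y i\<close> and add the remainder \<open>a \<otimes> b \<otimes> p i\<close>,
    which lies in \<open>K\<close> by \<open>ab_p\<close>.\<close>
  have cancel: "a \<otimes> b \<in> K"
    if "w \<in> mult_words R (x ` U)" "a \<otimes> b \<otimes> w \<in> K" "a \<in> I" "b \<in> J" "a \<in> E" "b \<in> E" for a b w
    using that
  proof (induction arbitrary: b)
    case one
    then show ?case by simp
  next
    case (mult g w)
    then obtain i where i: "i \<in> U" "g = x i" by blast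
    then have iN: "i \<in> N" using U by blast
    note [simp] = x_closed[OF iN] y_closed[OF iN] p_closed[OF iN]
    have w: "w \<in> carrier R" using mult.hyps(2) by (rule mult_words_closed) (use U x_closed in auto)
    have "a \<otimes> (b \<otimes> g) \<otimes> w \<in> K"
      using mult.prems w i by (simp add: m_assoc)
    then have 1: "a \<otimes> (b \<otimes> x i) \<in> K"
      using mult.prems i ex by (intro mult.IH J_mult E_mult) auto
    have "a \<otimes> b = a \<otimes> (b \<otimes> x i) \<otimes> y i \<oplus> a \<otimes> b \<otimes> p i"
    proof -
      have [simp]: "a \<in> carrier R" "b \<in> carrier R" using mult.prems by simp_all
      have "a \<otimes> b = a \<otimes> b \<otimes> x i \<otimes> y i \<oplus> a \<otimes> b \<otimes> p i"
        by (rule split_right[OF iN]) simp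
      also have "a \<otimes> b \<otimes> x i = a \<otimes> (b \<otimes> x i)" by (simp add: m_assoc)
      finally show ?thesis .
    qed
    then show ?case
      using 1 ab_p[OF i(1) mult.prems(2-5)] by (metis K_add K_mult(2) \<open>y i \<in> carrier R\<close>)
  qed
  define a' b' where "a' = e \<otimes> a \<otimes> e" and "b' = e \<otimes> b \<otimes> e"
  have a': "a' \<in> I" "a' \<in> E" and b': "b' \<in> J" "b' \<in> E"
    using psubset.prems(7,8) unfolding a'_def b'_def
    by (simp_all add: E_corner I_mult J_mult)
  obtain w where w: "w \<in> mult_words R (x ` U)" "a' \<otimes> b' \<otimes> w = b' \<otimes> a' \<otimes> w"
    using corner_commute_up_to_word[OF E_lspan[OF a'(2)] E_lspan[OF b'(2)] U e ex] by blast
  have "w \<in> carrier R" using w(1) by (rule mult_words_closed) (use U x_closed in auto)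
  then have "a' \<otimes> b' \<otimes> w \<in> K"
    unfolding w(2) using a' b' by (intro K_mult JIK)
  then have "a' \<otimes> b' \<in> K" using cancel w a' b' by blast
  then show ?case by (simp add: a'_def b'_def)
qed

text \<open>The whole ring is the corner of \<open>\<one>\<close> with all indices present, and here
  generation by \<open>gen_set N\<close> supplies the corner hypothesis. Sums are harmless, so
  products of two elements decide the inclusion.\<close>

lemma ideal_prod_subset_commute:
  assumes "finite N" and gen: "carrier R \<subseteq> lspan R (gen_set N) \<one>"
    and I: "ideal I R" and J: "ideal J R"
  shows "I \<cdot> J \<subseteq> J \<cdot> I"
proof
  fix s assume "s \<in> I \<cdot> J"
  then show "s \<in> J \<cdot> I"
  proof induction
    case (prod a b)
    have "(\<one> \<otimes> a \<otimes> \<one>) \<otimes> (\<one> \<otimes> b \<otimes> \<one>) \<in> J \<cdot> I"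
    proof (rule corner_prod_mem[OF \<open>finite N\<close> order_refl _ _ _ _ _ I J ideal_prod_is_ideal[OF J I]])
      show "\<one> \<otimes> s \<otimes> \<one> \<in> lspan R (gen_set N) \<one>" if "s \<in> carrier R" for s
        using gen that by auto
    qed (use prod in \<open>auto simp: x_closed y_closed intro: ideal_prod.prod\<close>)
    then show ?case using prod I J by (simp add: ideal.Icarr)
  next
    case (sum s t)
    then show ?case by (intro ideal_prod.sum)
  qed
qed

theorem ideal_prod_commute:
  assumes "finite N" "carrier R \<subseteq> lspan R (gen_set N) \<one>" "ideal I R" "ideal J R"
  shows "I \<cdot> J = J \<cdot> I"
  using assms by (intro equalityI ideal_prod_subset_commute)

end

subsection \<open>The free algebra and its quotient\<close>

text \<open>Both sides sum over all ways of cutting \<open>w\<close> into three consecutive pieces.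
  The auxiliary fact \<open>nested\<close> changes from indexing by the two cut positions to
  indexing by the lengths of the first two pieces.\<close>

lemma free_mult_assoc: "free_mult (free_mult f g) h = free_mult f (free_mult g h)"
proof
  fix w :: "gen list"
  let ?F = "\<lambda>i k. f (take i w) * g (take k (drop i w)) * h (drop (i + k) w)"
  have nested: "(\<Sum>j\<le>m. \<Sum>i\<le>j. F i (j - i)) = (\<Sum>i\<le>m. \<Sum>k\<le>m - i. F i k)"
    for m and F :: "nat \<Rightarrow> nat \<Rightarrow> 'a"
    by (induction m) (simp_all add: Suc_diff_le sum.distrib add.assoc)
  have "free_mult (free_mult f g) h w = (\<Sum>j\<le>length w. \<Sum>i\<le>j. ?F i (j - i))"
    unfolding free_mult_def
    by (auto simp: sum_distrib_right min_def drop_take intro!: sum.cong)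
  also have "\<dots> = (\<Sum>i\<le>length w. \<Sum>k\<le>length w - i. ?F i k)"
    by (rule nested)
  also have "\<dots> = free_mult f (free_mult g h) w"
    unfolding free_mult_def
    by (auto simp: sum_distrib_left mult.assoc add.commute intro!: sum.cong)
  finally show "free_mult (free_mult f g) h w = free_mult f (free_mult g h) w" .
qed

lemma free_mult_mon:
  "free_mult (mon u) f w = (if \<exists>v. w = u @ v then f (drop (length u) w) else 0)"
proof -
  have summand: "mon u (take i w) * f (drop i w) =
      (if i = length u then mon u (take (length u) w) * f (drop (length u) w) else 0)"
    if "i \<le> length w" for i
    using that by (auto simp: mon_def)
  have "free_mult (mon u) f w = (\<Sum>i\<le>length w.
      if i = length u then mon u (take (length u) w) * f (drop (length u) w) else 0)"
    unfolding free_mult_def by (rule sum.cong[OF refl], rule summand) simp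
  also have "\<dots> = (if length u \<le> length w \<and> take (length u) w = u then f (drop (length u) w) else 0)"
    by (simp add: mon_def)
  also have "length u \<le> length w \<and> take (length u) w = u \<longleftrightarrow> (\<exists>v. w = u @ v)"
  proof
    assume "length u \<le> length w \<and> take (length u) w = u"
    then have "w = u @ drop (length u) w" by (metis append_take_drop_id)
    then show "\<exists>v. w = u @ v" ..
  qed auto
  finally show ?thesis .
qed

lemma mon_mult_mon: "free_mult (mon u) (mon v) = mon (u @ v)"
  unfolding free_mult_mon by (rule ext) (auto simp: mon_def)

lemma free_mult_scaled_one: "free_mult (\<lambda>w. c * mon [] w) f = (\<lambda>w. c * f w)"
proof
  fix w
  have "free_mult (\<lambda>w. c * mon [] w) f w = c * free_mult (mon []) f w"
    by (simp add: free_mult_def sum_distrib_left mult.assoc)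
  then show "free_mult (\<lambda>w. c * mon [] w) f w = c * f w" by (simp add: free_mult_mon)
qed

lemma free_mult_scaled_one_right: "free_mult f (\<lambda>w. c * mon [] w) = (\<lambda>w. c * f w)"
proof
  fix w
  have "free_mult f (\<lambda>w. c * mon [] w) w = (\<Sum>i\<le>length w. if i = length w then c * f w else 0)"
    unfolding free_mult_def mon_def by (intro sum.cong) auto
  then show "free_mult f (\<lambda>w. c * mon [] w) w = c * f w" by simp
qed

text \<open>The support of a product consists of concatenations of words from the two supports,
  which gives both finiteness and the restriction on letters.\<close>

lemma free_mult_closed:
  assumes f: "f \<in> free_carrier n" and g: "g \<in> free_carrier n"
  shows "free_mult f g \<in> free_carrier n"
proof -
  have *: "\<exists>u v. w = u @ v \<and> f u \<noteq> 0 \<and> g v \<noteq> 0" if w: "free_mult f g w \<noteq> 0" for w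
  proof -
    obtain i where "f (take i w) * g (drop i w) \<noteq> 0"
      using w unfolding free_mult_def by (meson sum.not_neutral_contains_not_neutral)
    then show ?thesis
      by (intro exI[of _ "take i w"] exI[of _ "drop i w"]) auto
  qed
  have "{w. free_mult f g w \<noteq> 0} \<subseteq> (\<lambda>(u, v). u @ v) ` ({u. f u \<noteq> 0} \<times> {v. g v \<noteq> 0})"
  proof
    fix w assume "w \<in> {w. free_mult f g w \<noteq> 0}"
    then obtain u v where "w = u @ v" "f u \<noteq> 0" "g v \<noteq> 0" using *[of w] by blast
    then show "w \<in> (\<lambda>(u, v). u @ v) ` ({u. f u \<noteq> 0} \<times> {v. g v \<noteq> 0})"
      by (intro image_eqI[of _ _ "(u, v)"]) auto
  qed
  moreover have "finite \<dots>"
    using f g by (auto simp: free_carrier_def)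
  ultimately have "finite {w. free_mult f g w \<noteq> 0}"
    by (rule finite_subset)
  moreover have "set w \<subseteq> gens n" if w: "free_mult f g w \<noteq> 0" for w
  proof -
    obtain u v where "w = u @ v" "f u \<noteq> 0" "g v \<noteq> 0" using *[OF w] by blast
    then show ?thesis using f g by (simp add: free_carrier_def)
  qed
  ultimately show ?thesis by (simp add: free_carrier_def)
qed

lemma free_carrier_add:
  assumes "f \<in> free_carrier n" "g \<in> free_carrier n"
  shows "(\<lambda>w. f w + g w) \<in> free_carrier n"
proof -
  have "finite {w. f w + g w \<noteq> 0}"
    by (rule finite_subset[of _ "{w. f w \<noteq> 0} \<union> {w. g w \<noteq> 0}"])
      (use assms in \<open>auto simp: free_carrier_def\<close>)
  moreover have "set w \<subseteq> gens n" if "f w + g w \<noteq> 0" for w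
  proof -
    have "f w \<noteq> 0 \<or> g w \<noteq> 0" using that by auto
    then show ?thesis using assms by (auto simp: free_carrier_def)
  qed
  ultimately show ?thesis by (simp add: free_carrier_def)
qed

lemma free_carrier_scale: "f \<in> free_carrier n \<Longrightarrow> (\<lambda>w. c * f w) \<in> free_carrier n"
  by (auto simp: free_carrier_def elim: finite_subset[rotated])

lemma mon_closed: "set u \<subseteq> gens n \<Longrightarrow> mon u \<in> free_carrier n"
  by (auto simp: free_carrier_def mon_def)

lemma free_alg_simps [simp]:
  "carrier (free_alg n) = free_carrier n"
  "mult (free_alg n) = free_mult"
  "one (free_alg n) = mon []"
  "zero (free_alg n) = (\<lambda>w. 0)"
  "add (free_alg n) = (\<lambda>f g w. f w + g w)"
  by (simp_all add: free_alg_def)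

lemma ring_free_alg: "ring (free_alg n :: (gen list \<Rightarrow> 'k::field) ring)"
proof (rule ringI)
  show "abelian_group (free_alg n :: (gen list \<Rightarrow> 'k) ring)"
  proof (rule abelian_groupI)
    fix f :: "gen list \<Rightarrow> 'k" assume "f \<in> carrier (free_alg n)"
    then have "(\<lambda>w. - 1 * f w) \<in> free_carrier n" by (simp only: free_alg_simps free_carrier_scale)
    then show "\<exists>g \<in> carrier (free_alg n). g \<oplus>\<^bsub>free_alg n\<^esub> f = \<zero>\<^bsub>free_alg n\<^esub>"
      by (intro bexI[of _ "\<lambda>w. - 1 * f w"]) auto
  qed (auto simp: free_carrier_add ac_simps, simp add: free_carrier_def)
  show "Group.monoid (free_alg n :: (gen list \<Rightarrow> 'k) ring)"
    using free_mult_scaled_one[of 1] free_mult_scaled_one_right[of _ 1]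
    by (intro monoidI) (simp_all add: free_mult_closed free_mult_assoc mon_closed)
qed (auto simp: free_mult_def distrib_left distrib_right sum.distrib)

lemma minus_free_alg:
  assumes "f \<in> free_carrier n" "g \<in> free_carrier n"
  shows "f \<ominus>\<^bsub>free_alg n\<^esub> g = (\<lambda>w. f w - g w)"
proof -
  interpret ring "free_alg n :: (gen list \<Rightarrow> 'k::field) ring" by (rule ring_free_alg)
  have "(\<lambda>w. - 1 * g w) \<in> free_carrier n" using assms(2) by (rule free_carrier_scale)
  then have "\<ominus>\<^bsub>free_alg n\<^esub> g = (\<lambda>w. - 1 * g w)"
    using assms by (intro minus_equality) auto
  then show ?thesis by (simp add: a_minus_def)
qed

section \<open>Generation of the free algebra, and its transfer along homomorphisms\<close>

lemma lspan_hom: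
  assumes "t \<in> lspan R G e" "h \<in> ring_hom R R'" "ring R" "ring R'" "G \<subseteq> carrier R" "e \<in> carrier R"
  shows "h t \<in> lspan R' (h ` G) (h e)"
  using assms(1)
proof induction
  have closed: "t \<in> carrier R" if "t \<in> lspan R G e" for t
    using ring.lspan_closed[OF assms(3) that assms(5,6)] .
  {
    case zero
    then show ?case using ring_hom_zero[OF assms(2-4)] by (simp add: lspan.zero)
  next
    case base
    then show ?case by (rule lspan.base)
  next
    case (add s t)
    then show ?case using closed ring_hom_add[OF assms(2)] by (simp add: lspan.add)
  next
    case (mult a t)
    then have "h (a \<otimes>\<^bsub>R\<^esub> t) = h a \<otimes>\<^bsub>R'\<^esub> h t"
      using closed assms(5) by (intro ring_hom_mult[OF assms(2)]) auto
    then show ?case using mult by (simp add: lspan.mult)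
  }
qed

text \<open>The copy of the field inside the free algebra. Having it among the generators lets
  \<open>lspan\<close> produce scalar multiples.\<close>

definition scalars :: "(gen list \<Rightarrow> 'k::field) set" where
  "scalars = {\<lambda>w. c * mon [] w | c. True}"

lemma scalars_closed: "scalars \<subseteq> free_carrier n"
  by (auto simp: scalars_def intro!: free_carrier_scale mon_closed)

lemma free_alg_generated:
  assumes "f \<in> free_carrier n"
  shows "f \<in> lspan (free_alg n)
    (scalars \<union> (\<lambda>i. mon [X i]) ` {..<n} \<union> (\<lambda>i. mon [Y i]) ` {..<n}) (mon [])"
    (is "_ \<in> ?L")
proof -
  have scaled: "(\<lambda>w. c * g w) \<in> ?L" if "g \<in> ?L" for g and c :: 'a
  proof -
    have "free_mult (\<lambda>w. c * mon [] w) g \<in> ?L"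
      using lspan.mult[OF _ that] by (auto simp: scalars_def)
    then show ?thesis by (simp only: free_mult_scaled_one)
  qed
  have mon: "mon u \<in> ?L" if "set u \<subseteq> gens n" for u
    using that
  proof (induction u)
    case Nil
    show ?case by (rule lspan.base)
  next
    case (Cons g u)
    have "free_mult (mon [g]) (mon u) \<in> ?L"
      using lspan.mult[OF _ Cons.IH, of "mon [g]"] Cons.prems by (fastforce simp: gens_def)
    then show ?case by (simp add: mon_mult_mon)
  qed
  \<comment> \<open>Induction runs over a finite set that merely contains the support, so one
    coefficient can be split off whether or not it is zero.\<close>
  have "f \<in> ?L" if "finite F" "{w. f w \<noteq> 0} \<subseteq> F" "\<forall>w\<in>F. set w \<subseteq> gens n" for F and f :: "gen list \<Rightarrow> 'a"
    using that
  proof (induction F arbitrary: f)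
    case empty
    then have "f = (\<lambda>w. 0)" by auto
    then show ?case using lspan.zero[of "free_alg n"] by simp
  next
    case (insert u F)
    have u: "(\<lambda>w. f u * mon u w) \<in> ?L"
      using insert.prems by (intro scaled mon) auto
    have rest: "f(u := 0) \<in> ?L"
      using insert.prems by (intro insert.IH) auto
    have "(\<lambda>w. f u * mon u w + (f(u := 0)) w) \<in> ?L"
      using lspan.add[OF u rest] by (simp only: free_alg_simps)
    also have "(\<lambda>w. f u * mon u w + (f(u := 0)) w) = f"
      by (auto simp: mon_def)
    finally show ?case .
  qed
  from this[of "{w. f w \<noteq> 0}" f] show ?thesis
    using assms by (simp add: free_carrier_def)
qed

lemma rels_closed: "rels n \<subseteq> (free_carrier n :: (gen list \<Rightarrow> 'k::field) set)"
proof -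
  interpret ring "free_alg n :: (gen list \<Rightarrow> 'k) ring" by (rule ring_free_alg)
  have minus: "(\<lambda>w. f w - g w) \<in> free_carrier n" if "f \<in> free_carrier n" "g \<in> free_carrier n"
    for f g :: "gen list \<Rightarrow> 'k"
    using minus_closed[of f g] that by (simp add: minus_free_alg)
  then show ?thesis
    unfolding rels_def by (auto intro!: minus mon_closed simp: gens_def)
qed

section \<open>The quotient by the relations as an instance of the abstract setting\<close>

context
  fixes n :: nat and L :: "(gen list \<Rightarrow> 'k::field) set" and h
  defines "L \<equiv> genideal (free_alg n) (rels n)"
    and "h \<equiv> (\<lambda>f. L +>\<^bsub>free_alg n\<^esub> f)"
begin

lemma ideal_relations: "ideal L (free_alg n)"
  unfolding L_def using rels_closed by (intro ring.genideal_ideal ring_free_alg) simp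

lemma ring_S: "ring (S n :: (gen list \<Rightarrow> 'k) set ring)"
  using ideal.quotient_is_ring[OF ideal_relations] by (simp add: S_def L_def)

lemma proj_hom: "h \<in> ring_hom (free_alg n) (S n)"
  using ideal.rcos_ring_hom[OF ideal_relations] by (simp add: S_def L_def h_def)

lemma proj_onto: "carrier (S n) = h ` free_carrier n"
  by (auto simp: S_def FactRing_def A_RCOSETS_def' L_def h_def)

text \<open>Every defining relation is a difference of two monomials, so this one criterion turns
  all four families into equations in the quotient.\<close>

lemma proj_eqI:
  assumes "(\<lambda>w. mon u w - mon v w :: 'k) \<in> rels n" "set u \<subseteq> gens n" "set v \<subseteq> gens n"
  shows "h (mon u) = h (mon v)"
proof -
  interpret ring "free_alg n :: (gen list \<Rightarrow> 'k) ring" by (rule ring_free_alg)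
  have "(\<lambda>w. mon u w - mon v w) \<in> L"
    using genideal_self[of "rels n"] rels_closed assms(1) by (auto simp: L_def)
  then have "mon u \<ominus>\<^bsub>free_alg n\<^esub> mon v \<in> L"
    using assms by (simp add: minus_free_alg mon_closed)
  then show ?thesis
    using quotient_eq_iff_same_a_r_cos[OF ideal_relations, of "mon u" "mon v"] assms
    by (simp add: h_def mon_closed)
qed

lemma proj_mon_mult:
  assumes "set u \<subseteq> gens n" "set v \<subseteq> gens n"
  shows "h (mon u) \<otimes>\<^bsub>S n\<^esub> h (mon v) = h (mon (u @ v))"
  using ring_hom_mult[OF proj_hom, of "mon u" "mon v"] assms by (simp add: mon_closed mon_mult_mon)

interpretation S: one_sided_inverses "S n :: (gen list \<Rightarrow> 'k) set ring" "h ` scalars"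
  "\<lambda>i. h (mon [X i])" "\<lambda>i. h (mon [Y i])" "{..<n}"
proof (intro one_sided_inverses.intro one_sided_inverses_axioms.intro ring_S)
  have gens: "set [X i] \<subseteq> gens n" "set [Y i] \<subseteq> gens n" if "i \<in> {..<n}" for i
    using that by (auto simp: gens_def)
  show "h ` scalars \<subseteq> carrier (S n)"
    using scalars_closed unfolding proj_onto by (rule image_mono)
  show "c \<otimes>\<^bsub>S n\<^esub> s = s \<otimes>\<^bsub>S n\<^esub> c" if c: "c \<in> h ` scalars" and s: "s \<in> carrier (S n)" for c s
  proof -
    obtain k where "c = h (\<lambda>w. k * mon [] w)"
      using c by (auto simp: scalars_def)
    moreover have "(\<lambda>w. k * mon [] w) \<in> free_carrier n"
      by (intro free_carrier_scale mon_closed) simp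
    ultimately have k: "c = h (\<lambda>w. k * mon [] w)" "(\<lambda>w. k * mon [] w) \<in> free_carrier n" .
    obtain f where f: "s = h f" "f \<in> free_carrier n" using s by (auto simp: proj_onto)
    show ?thesis
      using ring_hom_mult[OF proj_hom, of "\<lambda>w. k * mon [] w" f]
        ring_hom_mult[OF proj_hom, of f "\<lambda>w. k * mon [] w"] k f
      by (simp add: free_mult_scaled_one free_mult_scaled_one_right)
  qed
  fix i assume i: "i \<in> {..<n}"
  show "h (mon [X i]) \<in> carrier (S n)" "h (mon [Y i]) \<in> carrier (S n)"
    using gens[OF i] by (simp_all add: proj_onto mon_closed)
  have "h (mon [Y i, X i]) = h (mon [])"
    using i by (intro proj_eqI) (auto simp: rels_def gens_def)
  then show "h (mon [Y i]) \<otimes>\<^bsub>S n\<^esub> h (mon [X i]) = \<one>\<^bsub>S n\<^esub>"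
    using gens[OF i] ring_hom_one[OF proj_hom] by (simp add: proj_mon_mult)
  fix j assume j: "j \<in> {..<n}"
  have *: "h (mon [X i, X j]) = h (mon [X j, X i])" "h (mon [Y i, Y j]) = h (mon [Y j, Y i])"
    "h (mon [X i, Y j]) = h (mon [Y j, X i])" if "i \<noteq> j"
    using i j that by (intro proj_eqI; force simp: rels_def gens_def)+
  show "h (mon [X i]) \<otimes>\<^bsub>S n\<^esub> h (mon [X j]) = h (mon [X j]) \<otimes>\<^bsub>S n\<^esub> h (mon [X i])"
    "h (mon [Y i]) \<otimes>\<^bsub>S n\<^esub> h (mon [Y j]) = h (mon [Y j]) \<otimes>\<^bsub>S n\<^esub> h (mon [Y i])"
    \<comment> \<open>The relations only speak of distinct indices; for equal indices the two sides
      coincide.\<close>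
    using gens[OF i] gens[OF j] * by (cases "i = j"; simp add: proj_mon_mult)+
  show "h (mon [X i]) \<otimes>\<^bsub>S n\<^esub> h (mon [Y j]) = h (mon [Y j]) \<otimes>\<^bsub>S n\<^esub> h (mon [X i])" if "i \<noteq> j"
    using gens[OF i] gens[OF j] *(3)[OF that] by (simp add: proj_mon_mult)
qed

text \<open>Generation is inherited from the free algebra because the projection is a surjective
  homomorphism sending generators to generators.\<close>

lemma S_generated: "carrier (S n :: (gen list \<Rightarrow> 'k) set ring) \<subseteq> lspan (S n) (S.gen_set {..<n}) \<one>\<^bsub>S n\<^esub>"
proof
  fix s :: "(gen list \<Rightarrow> 'k) set" assume "s \<in> carrier (S n)"
  then obtain f where f: "s = h f" "f \<in> free_carrier n" by (auto simp: proj_onto)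
  let ?G = "scalars \<union> (\<lambda>i. mon [X i]) ` {..<n} \<union> (\<lambda>i. mon [Y i]) ` {..<n}"
  have "?G \<subseteq> free_carrier n"
    using scalars_closed by (auto intro!: mon_closed simp: gens_def)
  then have "h f \<in> lspan (S n) (h ` ?G) (h (mon []))"
    using f by (intro lspan_hom[OF free_alg_generated proj_hom ring_free_alg ring_S])
      (auto simp: mon_closed)
  then show "s \<in> lspan (S n) (S.gen_set {..<n}) \<one>\<^bsub>S n\<^esub>"
    using ring_hom_one[OF proj_hom] by (simp add: f S.gen_set_def image_Un image_image)
qed

lemma ideal_prod_S_commute:
  fixes I J :: "(gen list \<Rightarrow> 'k) set set"
  assumes "ideal I (S n)" "ideal J (S n)"
  shows "ideal_prod (S n) I J = ideal_prod (S n) J I"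
  by (rule S.ideal_prod_commute[OF _ S_generated assms]) simp

end

theorem theorem2p8:
  fixes n :: nat and I J :: "(gen list \<Rightarrow> 'k::field) set set"
  assumes "n \<ge> 1" and "ideal I (S n)" and "ideal J (S n)"
  shows "ideal_prod (S n) I J = ideal_prod (S n) J I"
  using assms(2,3) by (rule ideal_prod_S_commute)

end
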